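(* Let $R$ be a commutative ring with identity, $M$ a finitely generated faithful multiplication $R$-module and $N$ a submodule of $M$. The following are equivalent: (1) $N$ is a weakly $J$-submodule of $M$. (2) $(N:M)$ is a weakly $J$-ideal of $R$. (3) $N=IM$ for some weakly $J$-ideal $I$ of $R$.
   Context: Rings are commutative with identity and modules are unital. $J(R)$ is the Jacobson radical of $R$. For a submodule $N$ of $M$, $(N:M)=\{r\in R: rM\subseteq N\}$. An $R$-module $M$ is a multiplication module if every submodule $N$ of $M$ has the form $N=IM$ for some ideal $I$ of $R$. A proper submodule $N$ of $M$ is a weakly $J$-submodule if whenever $r\in R$, $m\in M$ satisfy $0\neq rm\in N$ and $r\notin (J(R)M:M)$, then $m\in N$. A proper ideal $I$ of $R$ is a weakly $J$-ideal if whenever $a,b\in R$ satisfy $0\neq ab\in I$ and $a\notin J(R)$, then $b\in I$. *)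

theory Defs
  imports "HOL-Algebra.Algebra"
begin

(* Intersecting with the carrier only matters for the zero ring, which has no maximal ideals. *)
definition jacobson_radical :: "('a, 'r) ring_scheme \<Rightarrow> 'a set"
  where "jacobson_radical R = carrier R \<inter> \<Inter>{I. maximalideal I R}"

definition submodule_span ::
    "('a, 'r) ring_scheme \<Rightarrow> ('a, 'b, 'm) module_scheme \<Rightarrow> 'b set \<Rightarrow> 'b set"
  where "submodule_span R M S = \<Inter>{H. submodule H R M \<and> S \<subseteq> H}"

definition ideal_smult ::
    "('a, 'r) ring_scheme \<Rightarrow> ('a, 'b, 'm) module_scheme \<Rightarrow> 'a set \<Rightarrow> 'b set"
  where "ideal_smult R M I = submodule_span R M {a \<odot>\<^bsub>M\<^esub> m |a m. a \<in> I \<and> m \<in> carrier M}"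

(* The ideal (N : M). *)
definition residual ::
    "('a, 'r) ring_scheme \<Rightarrow> ('a, 'b, 'm) module_scheme \<Rightarrow> 'b set \<Rightarrow> 'a set"
  where "residual R M N = {r \<in> carrier R. \<forall>m \<in> carrier M. r \<odot>\<^bsub>M\<^esub> m \<in> N}"

definition multiplication_module ::
    "('a, 'r) ring_scheme \<Rightarrow> ('a, 'b, 'm) module_scheme \<Rightarrow> bool"
  where "multiplication_module R M \<longleftrightarrow>
    module R M \<and> (\<forall>N. submodule N R M \<longrightarrow> (\<exists>I. ideal I R \<and> N = ideal_smult R M I))"

definition finitely_generated_module ::
    "('a, 'r) ring_scheme \<Rightarrow> ('a, 'b, 'm) module_scheme \<Rightarrow> bool"
  where "finitely_generated_module R M \<longleftrightarrow>
    module R M \<and> (\<exists>S. finite S \<and> S \<subseteq> carrier M \<and> submodule_span R M S = carrier M)"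

definition faithful_module ::
    "('a, 'r) ring_scheme \<Rightarrow> ('a, 'b, 'm) module_scheme \<Rightarrow> bool"
  where "faithful_module R M \<longleftrightarrow>
    module R M \<and>
    (\<forall>r \<in> carrier R. (\<forall>m \<in> carrier M. r \<odot>\<^bsub>M\<^esub> m = \<zero>\<^bsub>M\<^esub>) \<longrightarrow> r = \<zero>\<^bsub>R\<^esub>)"

definition weakly_J_submodule ::
    "('a, 'r) ring_scheme \<Rightarrow> ('a, 'b, 'm) module_scheme \<Rightarrow> 'b set \<Rightarrow> bool"
  where "weakly_J_submodule R M N \<longleftrightarrow>
    submodule N R M \<and> N \<noteq> carrier M \<and>
    (\<forall>r \<in> carrier R. \<forall>m \<in> carrier M.
      r \<odot>\<^bsub>M\<^esub> m \<noteq> \<zero>\<^bsub>M\<^esub> \<and> r \<odot>\<^bsub>M\<^esub> m \<in> N \<and>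
      r \<notin> residual R M (ideal_smult R M (jacobson_radical R)) \<longrightarrow> m \<in> N)"

definition weakly_J_ideal :: "('a, 'r) ring_scheme \<Rightarrow> 'a set \<Rightarrow> bool"
  where "weakly_J_ideal R I \<longleftrightarrow>
    ideal I R \<and> I \<noteq> carrier R \<and>
    (\<forall>a \<in> carrier R. \<forall>b \<in> carrier R.
      a \<otimes>\<^bsub>R\<^esub> b \<noteq> \<zero>\<^bsub>R\<^esub> \<and> a \<otimes>\<^bsub>R\<^esub> b \<in> I \<and> a \<notin> jacobson_radical R \<longrightarrow> b \<in> I)"

end

theory Submission
  imports Defs
begin

text \<open>
  Write \<open>(N : M)\<close> for the residual and \<open>J\<close> for the Jacobson radical. Two facts about the module carry
  the equivalence. In a multiplication module \<open>N = (N : M) M\<close> for every submodule \<open>N\<close>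
  (\<open>multiplication_module_ideal_smult_residual\<close>), and if the module is moreover finitely
  generated and faithful, then \<open>(I M : M) = I\<close> for every ideal \<open>I\<close> (\<open>residual_ideal_smult\<close>). So
  \<open>N\<close> and \<open>(N : M)\<close> determine each other, which makes (2) and (3) equivalent, and
  \<open>(J M : M) = J\<close>, so that the exceptional scalars in the two definitions are the same.

  Passing between (1) and (2) then means passing between products of scalars and products of a
  scalar with a vector. The difficulty is the word "weakly": the hypothesis says nothing about
  vanishing products. Suppose \<open>0 \<noteq> a b \<in> (N : M)\<close> with \<open>a \<notin> J\<close>. Every vector \<open>y\<close> satisfies
  \<open>b y \<in> N\<close> or \<open>a b y = 0\<close>; both conditions define subgroups of \<open>M\<close>, and a group is
  never the union of two proper subgroups (\<open>additive_subgroup_subset_Un\<close>). As \<open>a b\<close> does not kill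
  \<open>M\<close>, the first condition holds for all \<open>y\<close>, that is, \<open>b \<in> (N : M)\<close>. Conversely, suppose
  \<open>0 \<noteq> r m \<in> N\<close> with \<open>r \<notin> J\<close> and write \<open>R m = K M\<close>. Every \<open>k \<in> K\<close> lies in \<open>(N : M)\<close> or
  satisfies \<open>k r = 0\<close>, and not all of them satisfy the latter, so \<open>K \<subseteq> (N : M)\<close> and \<open>m \<in> K M \<subseteq> N\<close>.

  The cancellation law \<open>(I M : M) = I\<close> comes from Nakayama's lemma. If \<open>P\<close> is a proper ideal, then
  \<open>P M \<noteq> M\<close>, and therefore some \<open>m\<close> has \<open>(R m : M)\<close> not contained in \<open>P\<close>: locally the module is
  cyclic (\<open>locally_cyclic\<close>). Given \<open>r M \<subseteq> I M\<close> and \<open>k M \<subseteq> R m\<close>, one gets \<open>k r m = a m\<close> with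
  \<open>a \<in> I\<close>. Then \<open>(k r - a) k\<close> kills \<open>M\<close>, so \<open>k\<^sup>2 r = k a \<in> I\<close>. Hence the ideal
  \<open>{x. x r \<in> I}\<close> lies in no maximal ideal, so it contains \<open>1\<close>.
\<close>

section \<open>Abelian groups and ideals\<close>

text \<open>The classical sum argument: with \<open>x \<in> A - B\<close> and \<open>y \<in> A - C\<close>, the element \<open>x + y\<close> can be
  neither in \<open>B\<close> nor in \<open>C\<close>. This is what replaces the missing information about
  vanishing products in the weak notions.\<close>

lemma (in abelian_group) additive_subgroup_subset_Un:
  assumes "additive_subgroup A G" "additive_subgroup B G" "additive_subgroup C G"
    and "A \<subseteq> B \<union> C"
  shows "A \<subseteq> B \<or> A \<subseteq> C"
proof (rule ccontr)
  interpret A: additive_subgroup A G by fact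
  interpret B: additive_subgroup B G by fact
  interpret C: additive_subgroup C G by fact
  assume "\<not> (A \<subseteq> B \<or> A \<subseteq> C)"
  then obtain x y where x: "x \<in> A" "x \<notin> B" and y: "y \<in> A" "y \<notin> C" by blast
  have xC: "x \<in> C" and yB: "y \<in> B" using x y assms(4) by auto
  have car: "x \<in> carrier G" "y \<in> carrier G" using x y by auto
  have "x \<oplus> y \<in> B \<union> C" using x y assms(4) by blast
  then show False
  proof
    assume "x \<oplus> y \<in> B"
    then have "x \<oplus> y \<oplus> \<ominus> y \<in> B" using yB by blast
    then show False using car x(2) by (simp add: a_assoc r_neg)
  next
    assume "x \<oplus> y \<in> C"
    then have "\<ominus> x \<oplus> (x \<oplus> y) \<in> C" using xC by blast
    then show False using car y(2) by (simp add: r_neg1)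
  qed
qed

lemma (in cring) idealI_cring:
  assumes "I \<subseteq> carrier R" "\<zero> \<in> I"
    and "\<And>x y. x \<in> I \<Longrightarrow> y \<in> I \<Longrightarrow> x \<oplus> y \<in> I"
    and "\<And>a x. a \<in> carrier R \<Longrightarrow> x \<in> I \<Longrightarrow> a \<otimes> x \<in> I"
  shows "ideal I R"
proof (rule idealI)
  show "ring R" by (rule ring_axioms)
  show "subgroup I (add_monoid R)"
  proof (rule add.subgroupI)
    fix x assume x: "x \<in> I"
    then have "\<ominus> \<one> \<otimes> x \<in> I" using assms(4) by simp
    then show "\<ominus> x \<in> I" using x assms(1) by (simp add: l_minus subset_iff)
  qed (use assms in auto)
next
  fix a x assume "a \<in> I" "x \<in> carrier R"
  then show "x \<otimes> a \<in> I" "a \<otimes> x \<in> I"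
    using assms(1) assms(4)[of x a] by (auto simp: m_comm subset_iff)
qed

lemma (in cring) ideal_colon:
  assumes "ideal I R" "r \<in> carrier R"
  shows "ideal {x \<in> carrier R. x \<otimes> r \<in> I} R"
proof -
  interpret I: ideal I R by fact
  show ?thesis
    by (rule idealI_cring) (use assms(2) I.I_l_closed in \<open>auto simp: l_distr m_assoc\<close>)
qed

text \<open>Inserting the carrier into the family keeps the family nonempty, so that the
  zero ring is covered as well.\<close>

lemma (in cring) ideal_jacobson_radical: "ideal (jacobson_radical R) R"
proof -
  have "jacobson_radical R = \<Inter>(insert (carrier R) {I. maximalideal I R})"
    by (simp add: jacobson_radical_def)
  then show ?thesis
    using i_Intersect[of "insert (carrier R) {I. maximalideal I R}"] oneideal
    by (auto intro: maximalideal.axioms(1))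
qed

text \<open>Krull's theorem: Zorn's lemma for the ideals that contain \<open>I\<close> and avoid \<open>\<one>\<close>; the latter
  condition is what makes properness survive unions of chains.\<close>

lemma (in cring) exists_maximalideal_above:
  assumes "ideal I R" "I \<noteq> carrier R"
  shows "\<exists>P. maximalideal P R \<and> I \<subseteq> P"
proof -
  define F where "F = {K. ideal K R \<and> I \<subseteq> K \<and> \<one> \<notin> K}"
  have one_notin: "\<one> \<notin> I" using ideal.one_imp_carrier assms by blast
  have IF: "I \<in> F" using assms one_notin by (simp add: F_def)
  have "\<exists>P\<in>F. \<forall>L\<in>F. P \<subseteq> L \<longrightarrow> L = P"
  proof (rule subset_Zorn_nonempty)
    show "F \<noteq> {}" using IF by blast
    fix C assume C: "C \<noteq> {}" "subset.chain F C"
    have sub: "\<And>K. K \<in> C \<Longrightarrow> ideal K R \<and> I \<subseteq> K \<and> \<one> \<notin> K"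
      using C(2) by (auto simp: F_def subset_chain_def)
    have "ideal (\<Union>C) R"
    proof (rule idealI_cring)
      show "\<Union>C \<subseteq> carrier R" using sub ideal.Icarr by fast
      show "\<zero> \<in> \<Union>C" using C(1) sub additive_subgroup.zero_closed ideal.axioms(1) by fast
    next
      fix x y assume "x \<in> \<Union>C" "y \<in> \<Union>C"
      then obtain K L where KL: "K \<in> C" "L \<in> C" "x \<in> K" "y \<in> L" by blast
      moreover have "K \<subseteq> L \<or> L \<subseteq> K" using C(2) KL by (auto simp: subset_chain_def)
      ultimately obtain T where "T \<in> C" "x \<in> T" "y \<in> T" by blast
      then show "x \<oplus> y \<in> \<Union>C"
        using sub additive_subgroup.a_closed ideal.axioms(1) by fast
    next
      fix a x assume "a \<in> carrier R" "x \<in> \<Union>C"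
      then show "a \<otimes> x \<in> \<Union>C" using sub ideal.I_l_closed by fast
    qed
    then show "\<Union>C \<in> F" using C(1) sub by (auto simp: F_def)
  qed
  then obtain P where P: "P \<in> F" and max: "\<And>L. L \<in> F \<Longrightarrow> P \<subseteq> L \<Longrightarrow> L = P" by blast
  have "maximalideal P R"
  proof (rule maximalidealI)
    show "ideal P R" using P by (simp add: F_def)
    show "carrier R \<noteq> P" using P by (auto simp: F_def)
    fix K assume "ideal K R" "P \<subseteq> K" "K \<subseteq> carrier R"
    then show "K = P \<or> K = carrier R"
      using P max[of K] ideal.one_imp_carrier[of K R] by (auto simp: F_def)
  qed
  then show ?thesis using P by (auto simp: F_def)
qed

section \<open>Submodules, spans and residuals\<close>

context module
begin

lemma submodule_carrier: "submodule H R M \<Longrightarrow> x \<in> H \<Longrightarrow> x \<in> carrier M"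
  using submoduleE(1) by blast

lemma submodule_zero: "submodule H R M \<Longrightarrow> \<zero>\<^bsub>M\<^esub> \<in> H"
  using submodule.axioms(1) subgroup.one_closed by fastforce

lemma submodule_additive_subgroup: "submodule H R M \<Longrightarrow> additive_subgroup H M"
  by (simp add: additive_subgroupI submodule.axioms(1))

lemma submoduleI_smult:
  assumes "H \<subseteq> carrier M" "\<zero>\<^bsub>M\<^esub> \<in> H"
    and "\<And>x y. x \<in> H \<Longrightarrow> y \<in> H \<Longrightarrow> x \<oplus>\<^bsub>M\<^esub> y \<in> H"
    and "\<And>a x. a \<in> carrier R \<Longrightarrow> x \<in> H \<Longrightarrow> a \<odot>\<^bsub>M\<^esub> x \<in> H"
  shows "submodule H R M"
proof (rule submoduleI)
  fix x assume x: "x \<in> H"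
  then have "(\<ominus> \<one>) \<odot>\<^bsub>M\<^esub> x \<in> H" using assms(4) by simp
  then show "\<ominus>\<^bsub>M\<^esub> x \<in> H" using x assms(1) by (simp add: smult_l_minus subset_iff)
qed (use assms in auto)

lemma submodule_zero_set: "submodule {\<zero>\<^bsub>M\<^esub>} R M"
  by (rule submoduleI_smult) auto

lemma smult_commute:
  "a \<in> carrier R \<Longrightarrow> b \<in> carrier R \<Longrightarrow> x \<in> carrier M \<Longrightarrow>
    a \<odot>\<^bsub>M\<^esub> (b \<odot>\<^bsub>M\<^esub> x) = b \<odot>\<^bsub>M\<^esub> (a \<odot>\<^bsub>M\<^esub> x)"
  by (metis m_comm smult_assoc1)

lemma smult_l_diff:
  "a \<in> carrier R \<Longrightarrow> b \<in> carrier R \<Longrightarrow> x \<in> carrier M \<Longrightarrow>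
    (a \<ominus> b) \<odot>\<^bsub>M\<^esub> x = a \<odot>\<^bsub>M\<^esub> x \<ominus>\<^bsub>M\<^esub> b \<odot>\<^bsub>M\<^esub> x"
  by (simp add: R.minus_eq M.minus_eq smult_l_distr smult_l_minus)

lemma submodule_smult_preimage:
  assumes H: "submodule H R M" and r: "r \<in> carrier R"
  shows "submodule {x \<in> carrier M. r \<odot>\<^bsub>M\<^esub> x \<in> H} R M"
proof (rule submoduleI_smult)
  fix a x assume "a \<in> carrier R" "x \<in> {x \<in> carrier M. r \<odot>\<^bsub>M\<^esub> x \<in> H}"
  then show "a \<odot>\<^bsub>M\<^esub> x \<in> {x \<in> carrier M. r \<odot>\<^bsub>M\<^esub> x \<in> H}"
    using r submoduleE(4)[OF H, of a "r \<odot>\<^bsub>M\<^esub> x"] by (simp add: smult_commute[of r a])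
qed (use r submodule_zero[OF H] submoduleE(5)[OF H] in \<open>auto simp: smult_r_distr\<close>)

text \<open>The sum \<open>A m + H\<close>. For \<open>A = R\<close> it describes the span after adding a generator, for \<open>H = 0\<close> it
  is the submodule \<open>A m\<close>, and for a smaller ideal \<open>A\<close> it is where \<open>x M\<close> lands in
  the proof of Nakayama's lemma.\<close>

definition smult_plus :: "'a set \<Rightarrow> 'c \<Rightarrow> 'c set \<Rightarrow> 'c set"
  where "smult_plus A m H = {a \<odot>\<^bsub>M\<^esub> m \<oplus>\<^bsub>M\<^esub> h |a h. a \<in> A \<and> h \<in> H}"

lemma smult_plusI: "a \<in> A \<Longrightarrow> h \<in> H \<Longrightarrow> x = a \<odot>\<^bsub>M\<^esub> m \<oplus>\<^bsub>M\<^esub> h \<Longrightarrow> x \<in> smult_plus A m H"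
  unfolding smult_plus_def by blast

lemma smult_plusE:
  assumes "x \<in> smult_plus A m H"
  obtains a h where "a \<in> A" "h \<in> H" "x = a \<odot>\<^bsub>M\<^esub> m \<oplus>\<^bsub>M\<^esub> h"
  using assms unfolding smult_plus_def by blast

lemma submodule_smult_plus:
  assumes A: "ideal A R" and m: "m \<in> carrier M" and H: "submodule H R M"
  shows "submodule (smult_plus A m H) R M"
proof -
  interpret A: ideal A R by fact
  note Hc = submodule_carrier[OF H]
  show ?thesis
  proof (rule submoduleI_smult)
    show "smult_plus A m H \<subseteq> carrier M" using m Hc by (auto simp: smult_plus_def)
    show "\<zero>\<^bsub>M\<^esub> \<in> smult_plus A m H"
    proof -
      have "\<zero>\<^bsub>M\<^esub> = \<zero> \<odot>\<^bsub>M\<^esub> m \<oplus>\<^bsub>M\<^esub> \<zero>\<^bsub>M\<^esub>" using m by simp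
      then show ?thesis
        by (rule smult_plusI[OF A.zero_closed submodule_zero[OF H]])
    qed
  next
    fix x y assume "x \<in> smult_plus A m H" "y \<in> smult_plus A m H"
    then obtain a h b g where *: "x = a \<odot>\<^bsub>M\<^esub> m \<oplus>\<^bsub>M\<^esub> h" "y = b \<odot>\<^bsub>M\<^esub> m \<oplus>\<^bsub>M\<^esub> g"
      "a \<in> A" "h \<in> H" "b \<in> A" "g \<in> H" by (blast elim: smult_plusE)
    then have eq: "x \<oplus>\<^bsub>M\<^esub> y = (a \<oplus> b) \<odot>\<^bsub>M\<^esub> m \<oplus>\<^bsub>M\<^esub> (h \<oplus>\<^bsub>M\<^esub> g)"
      using m Hc A.Icarr by (simp add: smult_l_distr M.a_ac)
    then show "x \<oplus>\<^bsub>M\<^esub> y \<in> smult_plus A m H"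
      using * by (intro smult_plusI[OF _ _ eq] A.a_closed submoduleE(5)[OF H])
  next
    fix c x assume c: "c \<in> carrier R" and "x \<in> smult_plus A m H"
    then obtain a h where *: "x = a \<odot>\<^bsub>M\<^esub> m \<oplus>\<^bsub>M\<^esub> h" "a \<in> A" "h \<in> H"
      by (blast elim: smult_plusE)
    then have eq: "c \<odot>\<^bsub>M\<^esub> x = (c \<otimes> a) \<odot>\<^bsub>M\<^esub> m \<oplus>\<^bsub>M\<^esub> c \<odot>\<^bsub>M\<^esub> h"
      using c m Hc A.Icarr by (simp add: smult_r_distr smult_assoc1)
    then show "c \<odot>\<^bsub>M\<^esub> x \<in> smult_plus A m H"
      using * c by (intro smult_plusI[OF _ _ eq] A.I_l_closed submoduleE(4)[OF H])
  qed
qed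

lemma smult_plus_zero:
  assumes "A \<subseteq> carrier R" "m \<in> carrier M"
  shows "smult_plus A m {\<zero>\<^bsub>M\<^esub>} = (\<lambda>a. a \<odot>\<^bsub>M\<^esub> m) ` A"
proof -
  have "smult_plus A m {\<zero>\<^bsub>M\<^esub>} = (\<lambda>a. a \<odot>\<^bsub>M\<^esub> m \<oplus>\<^bsub>M\<^esub> \<zero>\<^bsub>M\<^esub>) ` A"
    unfolding smult_plus_def by blast
  also have "\<dots> = (\<lambda>a. a \<odot>\<^bsub>M\<^esub> m) ` A"
    by (rule image_cong) (use assms in auto)
  finally show ?thesis .
qed

lemma submodule_cyclic:
  assumes "ideal A R" "m \<in> carrier M"
  shows "submodule ((\<lambda>a. a \<odot>\<^bsub>M\<^esub> m) ` A) R M"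
  using submodule_smult_plus[OF assms submodule_zero_set] smult_plus_zero[of A m] assms
  by (metis ideal.Icarr subsetI)

lemma mem_cyclic: "m \<in> carrier M \<Longrightarrow> m \<in> (\<lambda>a. a \<odot>\<^bsub>M\<^esub> m) ` carrier R"
  by (rule image_eqI[of _ _ \<one>]) auto

lemma submodule_span_least:
  "submodule H R M \<Longrightarrow> S \<subseteq> H \<Longrightarrow> submodule_span R M S \<subseteq> H"
  by (auto simp: submodule_span_def)

lemma submodule_span_superset: "S \<subseteq> submodule_span R M S"
  by (auto simp: submodule_span_def)

lemma submodule_submodule_span:
  assumes "S \<subseteq> carrier M"
  shows "submodule (submodule_span R M S) R M"
proof (rule submoduleI_smult)
  show "submodule_span R M S \<subseteq> carrier M"
    using submodule_span_least[OF carrier_is_submodule assms] .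
qed (auto simp: submodule_span_def submodule_zero submoduleE(4,5))

lemma ideal_smult_generators_subset:
  "ideal I R \<Longrightarrow> {a \<odot>\<^bsub>M\<^esub> m |a m. a \<in> I \<and> m \<in> carrier M} \<subseteq> carrier M"
  using ideal.Icarr by fastforce

lemma submodule_ideal_smult: "ideal I R \<Longrightarrow> submodule (ideal_smult R M I) R M"
  unfolding ideal_smult_def
  by (rule submodule_submodule_span[OF ideal_smult_generators_subset])

lemma smult_mem_ideal_smult:
  "a \<in> I \<Longrightarrow> m \<in> carrier M \<Longrightarrow> a \<odot>\<^bsub>M\<^esub> m \<in> ideal_smult R M I"
  unfolding ideal_smult_def by (rule subsetD[OF submodule_span_superset]) auto

text \<open>The form in which all inclusions out of \<open>I M\<close> are proved: instead of writing an element of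
  \<open>I M\<close> as a finite sum, one exhibits the wanted property as a submodule, usually the preimage of a
  submodule under multiplication by a scalar.\<close>

lemma ideal_smult_least:
  assumes "submodule H R M"
    and "\<And>a m. a \<in> I \<Longrightarrow> m \<in> carrier M \<Longrightarrow> a \<odot>\<^bsub>M\<^esub> m \<in> H"
  shows "ideal_smult R M I \<subseteq> H"
  unfolding ideal_smult_def using assms by (intro submodule_span_least) auto

lemma ideal_residual:
  assumes N: "submodule N R M"
  shows "ideal (residual R M N) R"
  by (rule idealI_cring)
    (use submodule_zero[OF N] submoduleE(4,5)[OF N] in
      \<open>auto simp: residual_def smult_l_distr smult_assoc1\<close>)

lemma ideal_smult_residual_subset:
  "submodule N R M \<Longrightarrow> ideal_smult R M (residual R M N) \<subseteq> N"
  by (rule ideal_smult_least) (auto simp: residual_def)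

lemma ideal_subset_residual_ideal_smult:
  "ideal I R \<Longrightarrow> I \<subseteq> residual R M (ideal_smult R M I)"
  using ideal.Icarr smult_mem_ideal_smult by (fastforce simp: residual_def)

lemma residual_eq_carrier_iff:
  assumes "submodule N R M"
  shows "residual R M N = carrier R \<longleftrightarrow> N = carrier M"
proof
  assume "residual R M N = carrier R"
  then have "\<one> \<in> residual R M N" by simp
  then have "carrier M \<subseteq> N" by (auto simp: residual_def)
  then show "N = carrier M" using submoduleE(1)[OF assms] by blast
qed (auto simp: residual_def)

text \<open>If \<open>N = I M\<close> for any ideal \<open>I\<close>, then \<open>I \<subseteq> (N : M)\<close>, so the residual is the largest
  choice of \<open>I\<close>.\<close>

lemma multiplication_module_ideal_smult_residual:
  assumes mult: "multiplication_module R M" and N: "submodule N R M"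
  shows "ideal_smult R M (residual R M N) = N"
proof
  show "ideal_smult R M (residual R M N) \<subseteq> N" by (rule ideal_smult_residual_subset[OF N])
  obtain I where I: "ideal I R" "N = ideal_smult R M I"
    using mult N unfolding multiplication_module_def by blast
  have "ideal_smult R M I \<subseteq> ideal_smult R M (residual R M N)"
    using ideal_subset_residual_ideal_smult[OF I(1)] I(2) smult_mem_ideal_smult
    by (intro ideal_smult_least submodule_ideal_smult ideal_residual[OF N]) auto
  then show "N \<subseteq> ideal_smult R M (residual R M N)" using I(2) by simp
qed

section \<open>Nakayama's lemma\<close>

lemma submodule_span_insert_subset:
  assumes "m \<in> carrier M" "S \<subseteq> carrier M"
  shows "submodule_span R M (insert m S) \<subseteq> smult_plus (carrier R) m (submodule_span R M S)"
proof (rule submodule_span_least)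
  let ?H = "submodule_span R M S"
  have H: "submodule ?H R M" by (rule submodule_submodule_span[OF assms(2)])
  show "submodule (smult_plus (carrier R) m ?H) R M"
    by (rule submodule_smult_plus[OF oneideal assms(1) H])
  have "m = \<one> \<odot>\<^bsub>M\<^esub> m \<oplus>\<^bsub>M\<^esub> \<zero>\<^bsub>M\<^esub>" using assms by simp
  then have "m \<in> smult_plus (carrier R) m ?H"
    by (intro smult_plusI[OF R.one_closed submodule_zero[OF H]])
  moreover have "s \<in> smult_plus (carrier R) m ?H" if "s \<in> S" for s
  proof -
    have "s = \<zero> \<odot>\<^bsub>M\<^esub> m \<oplus>\<^bsub>M\<^esub> s" using assms that by auto
    moreover have "s \<in> ?H" using that submodule_span_superset by blast
    ultimately show ?thesis by (intro smult_plusI[OF R.zero_closed])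
  qed
  ultimately show "insert m S \<subseteq> smult_plus (carrier R) m ?H" by blast
qed

text \<open>Determinant-free elimination of generators. Suppose that \<open>x \<in> 1 + A\<close> maps \<open>M\<close> into
  \<open>R m + H\<close>. Since \<open>M = A M\<close>, it maps \<open>M\<close> into \<open>A m + H\<close>, so \<open>x m = a m + h\<close> with \<open>a \<in> A\<close> and
  \<open>h \<in> H\<close>. Then \<open>x - a\<close> maps \<open>R m + H\<close> into \<open>H\<close>, and \<open>(x - a) x\<close> is an element of \<open>1 + A\<close>
  that maps \<open>M\<close> into \<open>H\<close>. The scalar has to be arbitrary in the induction because
  each elimination changes it.\<close>

lemma nakayama_eliminate_generators:
  assumes A: "ideal A R" and AM: "ideal_smult R M A = carrier M"
    and "finite S" "S \<subseteq> carrier M"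
    and "x \<in> carrier R" "\<one> \<ominus> x \<in> A"
    and "\<And>y. y \<in> carrier M \<Longrightarrow> x \<odot>\<^bsub>M\<^esub> y \<in> submodule_span R M S"
  shows "\<exists>z \<in> carrier R. \<one> \<ominus> z \<in> A \<and> (\<forall>y \<in> carrier M. z \<odot>\<^bsub>M\<^esub> y = \<zero>\<^bsub>M\<^esub>)"
  using assms(3-)
proof (induction S arbitrary: x rule: finite_induct)
  case empty
  have "submodule_span R M {} \<subseteq> {\<zero>\<^bsub>M\<^esub>}"
    by (rule submodule_span_least[OF submodule_zero_set]) simp
  then show ?case using empty by blast
next
  case (insert m S)
  interpret A: ideal A R by (rule A)
  have m: "m \<in> carrier M" and S: "S \<subseteq> carrier M" using insert.prems(1) by auto
  have x: "x \<in> carrier R" "\<one> \<ominus> x \<in> A" by (rule insert.prems)+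
  define H where "H = submodule_span R M S"
  have H: "submodule H R M" unfolding H_def by (rule submodule_submodule_span[OF S])
  note Hc = submodule_carrier[OF H]
  have xM: "\<exists>r\<in>carrier R. \<exists>h\<in>H. x \<odot>\<^bsub>M\<^esub> y = r \<odot>\<^bsub>M\<^esub> m \<oplus>\<^bsub>M\<^esub> h" if "y \<in> carrier M" for y
    using submodule_span_insert_subset[OF m S] insert.prems(4)[OF that]
    unfolding H_def by (blast elim: smult_plusE)
  have "ideal_smult R M A \<subseteq> {y \<in> carrier M. x \<odot>\<^bsub>M\<^esub> y \<in> smult_plus A m H}"
  proof (rule ideal_smult_least)
    show "submodule {y \<in> carrier M. x \<odot>\<^bsub>M\<^esub> y \<in> smult_plus A m H} R M"
      by (rule submodule_smult_preimage[OF submodule_smult_plus[OF A m H] x(1)])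
    fix a y assume a: "a \<in> A" and y: "y \<in> carrier M"
    obtain r h where rh: "r \<in> carrier R" "h \<in> H" "x \<odot>\<^bsub>M\<^esub> y = r \<odot>\<^bsub>M\<^esub> m \<oplus>\<^bsub>M\<^esub> h"
      using xM[OF y] by blast
    have "x \<odot>\<^bsub>M\<^esub> (a \<odot>\<^bsub>M\<^esub> y) = a \<odot>\<^bsub>M\<^esub> (x \<odot>\<^bsub>M\<^esub> y)"
      using a x(1) y A.Icarr by (simp add: smult_commute)
    also have "\<dots> = (a \<otimes> r) \<odot>\<^bsub>M\<^esub> m \<oplus>\<^bsub>M\<^esub> a \<odot>\<^bsub>M\<^esub> h"
      using a rh m Hc A.Icarr by (simp add: smult_r_distr smult_assoc1)
    finally have eq: "x \<odot>\<^bsub>M\<^esub> (a \<odot>\<^bsub>M\<^esub> y) = (a \<otimes> r) \<odot>\<^bsub>M\<^esub> m \<oplus>\<^bsub>M\<^esub> a \<odot>\<^bsub>M\<^esub> h" .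
    have "a \<otimes> r \<in> A" "a \<odot>\<^bsub>M\<^esub> h \<in> H"
      using a rh A.I_r_closed A.Icarr submoduleE(4)[OF H] by auto
    then have "x \<odot>\<^bsub>M\<^esub> (a \<odot>\<^bsub>M\<^esub> y) \<in> smult_plus A m H" by (rule smult_plusI[OF _ _ eq])
    then show "a \<odot>\<^bsub>M\<^esub> y \<in> {y \<in> carrier M. x \<odot>\<^bsub>M\<^esub> y \<in> smult_plus A m H}"
      using a y A.Icarr by simp
  qed
  then have "x \<odot>\<^bsub>M\<^esub> m \<in> smult_plus A m H" using AM m by blast
  then obtain a h where a: "a \<in> A" and h: "h \<in> H" and xm: "x \<odot>\<^bsub>M\<^esub> m = a \<odot>\<^bsub>M\<^esub> m \<oplus>\<^bsub>M\<^esub> h"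
    by (blast elim: smult_plusE)
  have ac: "a \<in> carrier R" using a by (rule A.Icarr)
  have diff: "(x \<ominus> a) \<odot>\<^bsub>M\<^esub> m = h"
    using x ac m Hc[OF h] xm
    by (simp add: smult_l_diff M.minus_eq M.a_ac M.r_neg)
  define z where "z = (x \<ominus> a) \<otimes> x"
  have z: "z \<in> carrier R" using x ac by (simp add: z_def)
  have "\<one> \<ominus> z = (\<one> \<oplus> x) \<otimes> (\<one> \<ominus> x) \<oplus> x \<otimes> a"
    unfolding z_def using x(1) ac by algebra
  then have zA: "\<one> \<ominus> z \<in> A" using x a A.I_l_closed by simp
  have zH: "z \<odot>\<^bsub>M\<^esub> y \<in> H" if y: "y \<in> carrier M" for y
  proof -
    obtain r g where rg: "r \<in> carrier R" "g \<in> H" "x \<odot>\<^bsub>M\<^esub> y = r \<odot>\<^bsub>M\<^esub> m \<oplus>\<^bsub>M\<^esub> g"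
      using xM[OF y] by blast
    have "z \<odot>\<^bsub>M\<^esub> y = (x \<ominus> a) \<odot>\<^bsub>M\<^esub> (r \<odot>\<^bsub>M\<^esub> m \<oplus>\<^bsub>M\<^esub> g)"
      unfolding z_def using x(1) ac y rg by (simp add: smult_assoc1)
    also have "\<dots> = r \<odot>\<^bsub>M\<^esub> h \<oplus>\<^bsub>M\<^esub> (x \<ominus> a) \<odot>\<^bsub>M\<^esub> g"
      using x(1) ac rg m Hc diff by (simp add: smult_r_distr smult_commute[of "x \<ominus> a"])
    also have "\<dots> \<in> H"
      using x(1) ac rg h by (intro submoduleE(4,5)[OF H]) auto
    finally show ?thesis .
  qed
  show ?case using insert.IH[OF S z zA] zH by (simp add: H_def)
qed

lemma nakayama:
  assumes "finitely_generated_module R M" "ideal A R" "ideal_smult R M A = carrier M"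
  shows "\<exists>z \<in> carrier R. \<one> \<ominus> z \<in> A \<and> (\<forall>y \<in> carrier M. z \<odot>\<^bsub>M\<^esub> y = \<zero>\<^bsub>M\<^esub>)"
proof -
  obtain S where S: "finite S" "S \<subseteq> carrier M" "submodule_span R M S = carrier M"
    using assms(1) unfolding finitely_generated_module_def by blast
  have "\<one> \<ominus> \<one> \<in> A"
    using ideal.axioms(1)[OF assms(2)] additive_subgroup.zero_closed by (fastforce simp: R.minus_eq R.r_neg)
  then show ?thesis using nakayama_eliminate_generators[OF assms(2,3) S(1,2), of \<one>] S(3) by simp
qed

lemma faithful_fg_ideal_smult_proper:
  assumes "finitely_generated_module R M" "faithful_module R M"
    and A: "ideal A R" "A \<noteq> carrier R"
  shows "ideal_smult R M A \<noteq> carrier M"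
proof
  assume "ideal_smult R M A = carrier M"
  then obtain z where z: "z \<in> carrier R" "\<one> \<ominus> z \<in> A" "\<forall>y \<in> carrier M. z \<odot>\<^bsub>M\<^esub> y = \<zero>\<^bsub>M\<^esub>"
    using nakayama[OF assms(1,3)] by blast
  then have "z = \<zero>" using assms(2) unfolding faithful_module_def by blast
  then have "\<one> \<in> A" using z(2) by (simp add: R.minus_eq)
  then show False using A ideal.one_imp_carrier by blast
qed

section \<open>Cancellation in faithful multiplication modules\<close>

text \<open>Otherwise \<open>(R m : M) \<subseteq> P\<close> for every \<open>m\<close>, so that \<open>m \<in> R m = (R m : M) M \<subseteq> P M\<close>, and
  \<open>P M = M\<close> contradicts Nakayama's lemma.\<close>

lemma locally_cyclic:
  assumes fg: "finitely_generated_module R M" and faithful: "faithful_module R M"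
    and mult: "multiplication_module R M" and P: "ideal P R" "P \<noteq> carrier R"
  shows "\<exists>k \<in> carrier R. \<exists>m \<in> carrier M. k \<notin> P \<and>
    (\<forall>y \<in> carrier M. k \<odot>\<^bsub>M\<^esub> y \<in> (\<lambda>a. a \<odot>\<^bsub>M\<^esub> m) ` carrier R)"
proof (rule ccontr)
  assume neg: "\<not> ?thesis"
  have "m \<in> ideal_smult R M P" if m: "m \<in> carrier M" for m
  proof -
    let ?C = "(\<lambda>a. a \<odot>\<^bsub>M\<^esub> m) ` carrier R"
    have C: "submodule ?C R M" by (rule submodule_cyclic[OF oneideal m])
    have "residual R M ?C \<subseteq> P" using neg m by (auto simp: residual_def)
    then have "ideal_smult R M (residual R M ?C) \<subseteq> ideal_smult R M P"
      using smult_mem_ideal_smult by (intro ideal_smult_least submodule_ideal_smult P(1)) auto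
    then show ?thesis
      using multiplication_module_ideal_smult_residual[OF mult C] mem_cyclic[OF m] by auto
  qed
  then have "ideal_smult R M P = carrier M"
    using submoduleE(1)[OF submodule_ideal_smult[OF P(1)]] by blast
  then show False using faithful_fg_ideal_smult_proper[OF fg faithful P] by blast
qed

text \<open>The cancellation law. It suffices to show that the colon ideal \<open>Q = {x. x r \<in> I}\<close> is in no
  maximal ideal \<open>P\<close>. If \<open>k \<notin> P\<close> and \<open>k M \<subseteq> R m\<close>, then \<open>k\<^sup>2 \<in> Q\<close>: one factor \<open>k\<close> moves
  the question into \<open>R m\<close>, where elements of \<open>I M\<close> become multiples \<open>a m\<close> with \<open>a \<in> I\<close>; the other
  turns the annihilation of \<open>m\<close> by \<open>k r - a\<close> into annihilation of \<open>M\<close>, where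
  faithfulness applies. Since \<open>P\<close> is prime, \<open>k\<^sup>2 \<notin> P\<close>.\<close>

lemma residual_ideal_smult:
  assumes fg: "finitely_generated_module R M" and faithful: "faithful_module R M"
    and mult: "multiplication_module R M" and I: "ideal I R"
  shows "residual R M (ideal_smult R M I) = I"
proof
  interpret I: ideal I R by (rule I)
  show "I \<subseteq> residual R M (ideal_smult R M I)" by (rule ideal_subset_residual_ideal_smult[OF I])
  show "residual R M (ideal_smult R M I) \<subseteq> I"
  proof
    fix r assume "r \<in> residual R M (ideal_smult R M I)"
    then have r: "r \<in> carrier R" and rM: "\<And>y. y \<in> carrier M \<Longrightarrow> r \<odot>\<^bsub>M\<^esub> y \<in> ideal_smult R M I"
      by (auto simp: residual_def)
    define Q where "Q = {x \<in> carrier R. x \<otimes> r \<in> I}"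
    have Q: "ideal Q R" unfolding Q_def by (rule ideal_colon[OF I r])
    have "Q = carrier R"
    proof (rule ccontr)
      assume "Q \<noteq> carrier R"
      then obtain P where P: "maximalideal P R" "Q \<subseteq> P"
        using exists_maximalideal_above[OF Q] by blast
      interpret P: primeideal P R by (rule maximalideal_prime[OF P(1)])
      obtain k m where k: "k \<in> carrier R" "k \<notin> P" and m: "m \<in> carrier M"
        and kM: "\<And>y. y \<in> carrier M \<Longrightarrow> k \<odot>\<^bsub>M\<^esub> y \<in> (\<lambda>a. a \<odot>\<^bsub>M\<^esub> m) ` carrier R"
        using locally_cyclic[OF fg faithful mult P.is_ideal] P.I_notcarr by blast
      have "ideal_smult R M I \<subseteq> {y \<in> carrier M. k \<odot>\<^bsub>M\<^esub> y \<in> (\<lambda>a. a \<odot>\<^bsub>M\<^esub> m) ` I}"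
      proof (rule ideal_smult_least)
        show "submodule {y \<in> carrier M. k \<odot>\<^bsub>M\<^esub> y \<in> (\<lambda>a. a \<odot>\<^bsub>M\<^esub> m) ` I} R M"
          by (rule submodule_smult_preimage[OF submodule_cyclic[OF I m] k(1)])
        fix a y assume a: "a \<in> I" and y: "y \<in> carrier M"
        obtain c where c: "c \<in> carrier R" "k \<odot>\<^bsub>M\<^esub> y = c \<odot>\<^bsub>M\<^esub> m" using kM[OF y] by blast
        have "k \<odot>\<^bsub>M\<^esub> (a \<odot>\<^bsub>M\<^esub> y) = a \<odot>\<^bsub>M\<^esub> (k \<odot>\<^bsub>M\<^esub> y)"
          using a k(1) y I.Icarr by (simp add: smult_commute)
        also have "\<dots> = (a \<otimes> c) \<odot>\<^bsub>M\<^esub> m" using a c m I.Icarr by (simp add: smult_assoc1)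
        finally have "k \<odot>\<^bsub>M\<^esub> (a \<odot>\<^bsub>M\<^esub> y) = (a \<otimes> c) \<odot>\<^bsub>M\<^esub> m" .
        moreover have "a \<otimes> c \<in> I" using a c I.I_r_closed by blast
        ultimately show "a \<odot>\<^bsub>M\<^esub> y \<in> {y \<in> carrier M. k \<odot>\<^bsub>M\<^esub> y \<in> (\<lambda>a. a \<odot>\<^bsub>M\<^esub> m) ` I}"
          using a y I.Icarr by blast
      qed
      then obtain a where a: "a \<in> I" "k \<odot>\<^bsub>M\<^esub> (r \<odot>\<^bsub>M\<^esub> m) = a \<odot>\<^bsub>M\<^esub> m"
        using rM[OF m] by blast
      have ac: "a \<in> carrier R" using a(1) by (rule I.Icarr)
      define d where "d = k \<otimes> r \<ominus> a"
      have d: "d \<in> carrier R" using k(1) r ac by (simp add: d_def)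
      have dm: "d \<odot>\<^bsub>M\<^esub> m = \<zero>\<^bsub>M\<^esub>"
        using k(1) r ac m a(2) unfolding d_def
        by (simp add: smult_l_diff smult_assoc1 M.minus_eq M.r_neg)
      have "(d \<otimes> k) \<odot>\<^bsub>M\<^esub> y = \<zero>\<^bsub>M\<^esub>" if y: "y \<in> carrier M" for y
      proof -
        obtain c where c: "c \<in> carrier R" "k \<odot>\<^bsub>M\<^esub> y = c \<odot>\<^bsub>M\<^esub> m" using kM[OF y] by blast
        have "(d \<otimes> k) \<odot>\<^bsub>M\<^esub> y = c \<odot>\<^bsub>M\<^esub> (d \<odot>\<^bsub>M\<^esub> m)"
          using d k(1) y c m by (simp add: smult_assoc1 smult_commute)
        then show ?thesis using c dm by simp
      qed
      then have "d \<otimes> k = \<zero>" using faithful d k(1) unfolding faithful_module_def by blast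
      moreover have "(k \<otimes> k) \<otimes> r = d \<otimes> k \<oplus> k \<otimes> a"
        unfolding d_def using k(1) r ac by algebra
      ultimately have "(k \<otimes> k) \<otimes> r = k \<otimes> a" using k(1) ac by simp
      then have "k \<otimes> k \<in> Q" using k(1) a(1) I.I_l_closed by (simp add: Q_def)
      then show False using P(2) P.I_prime k by blast
    qed
    then have "\<one> \<otimes> r \<in> I" unfolding Q_def by blast
    then show "r \<in> I" using r by simp
  qed
qed

section \<open>Weakly J-submodules and weakly J-ideals\<close>

text \<open>Applying the hypothesis to \<open>a\<close> and \<open>b y\<close> fails exactly for those \<open>y\<close> with \<open>a b y = 0\<close>. They
  form a submodule, which is proper by faithfulness, and so they can be ignored.
  Cancellation for \<open>I = J\<close> turns \<open>a \<notin> J\<close> into \<open>a \<notin> (J M : M)\<close>.\<close>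

lemma weakly_J_ideal_residual:
  assumes fg: "finitely_generated_module R M" and faithful: "faithful_module R M"
    and mult: "multiplication_module R M" and wJ: "weakly_J_submodule R M N"
  shows "weakly_J_ideal R (residual R M N)"
proof -
  have N: "submodule N R M" "N \<noteq> carrier M"
    and N_wJ: "\<And>r m. r \<in> carrier R \<Longrightarrow> m \<in> carrier M \<Longrightarrow> r \<odot>\<^bsub>M\<^esub> m \<noteq> \<zero>\<^bsub>M\<^esub> \<Longrightarrow>
      r \<odot>\<^bsub>M\<^esub> m \<in> N \<Longrightarrow> r \<notin> jacobson_radical R \<Longrightarrow> m \<in> N"
    using wJ residual_ideal_smult[OF fg faithful mult ideal_jacobson_radical]
    unfolding weakly_J_submodule_def by auto
  have "b \<in> residual R M N"
    if a: "a \<in> carrier R" and b: "b \<in> carrier R" and nz: "a \<otimes> b \<noteq> \<zero>"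
      and ab: "a \<otimes> b \<in> residual R M N" and aJ: "a \<notin> jacobson_radical R" for a b
  proof -
    \<comment> \<open>The zero submodule is written as a set so that both pieces are preimages of submodules.\<close>
    let ?B = "{y \<in> carrier M. b \<odot>\<^bsub>M\<^esub> y \<in> N}"
    let ?C = "{y \<in> carrier M. (a \<otimes> b) \<odot>\<^bsub>M\<^esub> y \<in> {\<zero>\<^bsub>M\<^esub>}}"
    have "y \<in> ?B" if y: "y \<in> carrier M" "y \<notin> ?C" for y
    proof -
      have "a \<odot>\<^bsub>M\<^esub> (b \<odot>\<^bsub>M\<^esub> y) = (a \<otimes> b) \<odot>\<^bsub>M\<^esub> y" using a b y by (simp add: smult_assoc1)
      then have "a \<odot>\<^bsub>M\<^esub> (b \<odot>\<^bsub>M\<^esub> y) \<noteq> \<zero>\<^bsub>M\<^esub>" "a \<odot>\<^bsub>M\<^esub> (b \<odot>\<^bsub>M\<^esub> y) \<in> N"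
        using ab y by (auto simp: residual_def)
      then show ?thesis using N_wJ[OF a _ _ _ aJ] b y by simp
    qed
    then have "carrier M \<subseteq> ?B \<union> ?C" by blast
    moreover have "additive_subgroup ?B M" "additive_subgroup ?C M"
        "additive_subgroup (carrier M) M"
      by (intro submodule_additive_subgroup submodule_smult_preimage submodule_zero_set
          carrier_is_submodule N(1) b m_closed a)+
    ultimately have "carrier M \<subseteq> ?B \<or> carrier M \<subseteq> ?C"
      by (intro M.additive_subgroup_subset_Un)
    moreover have "\<not> carrier M \<subseteq> ?C"
      using faithful nz a b unfolding faithful_module_def by auto
    ultimately show ?thesis using b by (auto simp: residual_def)
  qed
  then show ?thesis
    using ideal_residual[OF N(1)] residual_eq_carrier_iff[OF N(1)] N(2)
    unfolding weakly_J_ideal_def by blast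
qed

text \<open>With \<open>R m = K M\<close>, the relation \<open>r m \<in> N\<close> says \<open>r K \<subseteq> (N : M)\<close>. The elements of \<open>K\<close>
  killed by \<open>r\<close> escape the hypothesis, but they are not all of \<open>K\<close>, since otherwise \<open>r\<close> would kill
  \<open>K M\<close> and with it \<open>m\<close>.\<close>

lemma weakly_J_submodule_of_residual:
  assumes mult: "multiplication_module R M" and N: "submodule N R M"
    and wJ: "weakly_J_ideal R (residual R M N)"
  shows "weakly_J_submodule R M N"
proof -
  have "m \<in> N"
    if r: "r \<in> carrier R" and m: "m \<in> carrier M" and nz: "r \<odot>\<^bsub>M\<^esub> m \<noteq> \<zero>\<^bsub>M\<^esub>"
      and rm: "r \<odot>\<^bsub>M\<^esub> m \<in> N"
      and rJ: "r \<notin> residual R M (ideal_smult R M (jacobson_radical R))" for r m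
  proof -
    let ?C = "(\<lambda>a. a \<odot>\<^bsub>M\<^esub> m) ` carrier R"
    define K where "K = residual R M ?C"
    define Z where "Z = {x \<in> carrier R. x \<otimes> r \<in> {\<zero>}}"
    have C: "submodule ?C R M" by (rule submodule_cyclic[OF oneideal m])
    have K: "ideal K R" unfolding K_def by (rule ideal_residual[OF C])
    have KM: "ideal_smult R M K = ?C"
      unfolding K_def by (rule multiplication_module_ideal_smult_residual[OF mult C])
    have Z: "ideal Z R" unfolding Z_def by (rule ideal_colon[OF zeroideal r])
    have rJ': "r \<notin> jacobson_radical R"
      using rJ ideal_subset_residual_ideal_smult[OF ideal_jacobson_radical] by blast
    have "k \<in> residual R M N" if k: "k \<in> K" "k \<notin> Z" for k
    proof -
      have kc: "k \<in> carrier R" using k(1) by (simp add: K_def residual_def)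
      have "(r \<otimes> k) \<odot>\<^bsub>M\<^esub> y \<in> N" if y: "y \<in> carrier M" for y
      proof -
        obtain c where c: "c \<in> carrier R" "k \<odot>\<^bsub>M\<^esub> y = c \<odot>\<^bsub>M\<^esub> m"
          using k(1) y by (auto simp: K_def residual_def)
        have "(r \<otimes> k) \<odot>\<^bsub>M\<^esub> y = c \<odot>\<^bsub>M\<^esub> (r \<odot>\<^bsub>M\<^esub> m)"
          using r kc y c m by (simp add: smult_assoc1 smult_commute)
        then show ?thesis using submoduleE(4)[OF N c(1) rm] by simp
      qed
      then have "r \<otimes> k \<in> residual R M N" using r kc by (simp add: residual_def)
      moreover have "r \<otimes> k \<noteq> \<zero>" using k(2) kc r by (simp add: Z_def m_comm)
      ultimately show ?thesis using wJ r kc rJ' unfolding weakly_J_ideal_def by blast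
    qed
    then have "K \<subseteq> residual R M N \<union> Z" by blast
    then have "K \<subseteq> residual R M N \<or> K \<subseteq> Z"
      by (intro R.additive_subgroup_subset_Un ideal.axioms(1) K Z ideal_residual[OF N])
    moreover have "\<not> K \<subseteq> Z"
    proof
      assume KZ: "K \<subseteq> Z"
      have "ideal_smult R M K \<subseteq> {y \<in> carrier M. r \<odot>\<^bsub>M\<^esub> y \<in> {\<zero>\<^bsub>M\<^esub>}}"
      proof (rule ideal_smult_least[OF submodule_smult_preimage[OF submodule_zero_set r]])
        fix k y assume "k \<in> K" and y: "y \<in> carrier M"
        then have "k \<in> carrier R" "k \<otimes> r = \<zero>" using KZ by (auto simp: Z_def)
        then show "k \<odot>\<^bsub>M\<^esub> y \<in> {y \<in> carrier M. r \<odot>\<^bsub>M\<^esub> y \<in> {\<zero>\<^bsub>M\<^esub>}}"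
          using r y by (simp add: m_comm flip: smult_assoc1)
      qed
      then show False using nz mem_cyclic[OF m] KM by blast
    qed
    ultimately have "ideal_smult R M K \<subseteq> N"
      by (intro ideal_smult_least[OF N]) (auto simp: residual_def)
    then show ?thesis using KM mem_cyclic[OF m] by blast
  qed
  then show ?thesis
    using N wJ residual_eq_carrier_iff[OF N]
    unfolding weakly_J_submodule_def weakly_J_ideal_def by blast
qed

end

theorem corollary1:
  fixes R :: "('a, 'r) ring_scheme"
    and M :: "('a, 'b, 'm) module_scheme"
    and N :: "'b set"
  assumes "cring R"
    and "module R M"
    and "finitely_generated_module R M"
    and "faithful_module R M"
    and "multiplication_module R M"
    and "submodule N R M"
  shows "(weakly_J_submodule R M N \<longleftrightarrow> weakly_J_ideal R (residual R M N)) \<and>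
    (weakly_J_ideal R (residual R M N) \<longleftrightarrow>
      (\<exists>I. weakly_J_ideal R I \<and> N = ideal_smult R M I))"
proof -
  interpret module R M by (rule assms(2))
  have "weakly_J_submodule R M N \<longleftrightarrow> weakly_J_ideal R (residual R M N)"
    using weakly_J_ideal_residual[OF assms(3-5)] weakly_J_submodule_of_residual[OF assms(5,6)]
    by blast
  moreover have "weakly_J_ideal R (residual R M N)"
    if "weakly_J_ideal R I" "N = ideal_smult R M I" for I
  proof -
    have "ideal I R" using that(1) by (simp add: weakly_J_ideal_def)
    then show ?thesis using that residual_ideal_smult[OF assms(3-5)] by simp
  qed
  moreover have "N = ideal_smult R M (residual R M N)"
    using multiplication_module_ideal_smult_residual[OF assms(5,6)] by simp
  ultimately show ?thesis by blast
qed

end
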